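(* Let $H$ be an endofunctor of a category $\mathcal A$ with finite coproducts, and let $Y$ be an object of $\mathcal A$. For an object $TY$ of $\mathcal A$ the following are equivalent: (1) $TY$ is (the carrier of) a final coalgebra for the functor $H(-)+Y$; (2) $TY$ is (the carrier of) a free complete Elgot algebra on $Y$.
   Context: Coproduct injections are $\mathrm{inl},\mathrm{inr}$. For an $H$-algebra $\alpha:HA\to A$, a flat equation morphism in $A$ is any morphism $e:X\to HX+A$; a solution is $e^\dagger:X\to A$ with $e^\dagger=[\alpha,\mathrm{id}_A]\cdot(He^\dagger+\mathrm{id}_A)\cdot e$. For $e:X\to HX+Y$ and $h:Y\to Z$, $h\bullet e:=(\mathrm{id}_{HX}+h)\cdot e$; for $e:X\to HX+Y$, $f:Y\to HY+A$, $f\oplus e:=(\mathrm{can}+\mathrm{id}_A)\cdot(\mathrm{id}_{HX}+f)\cdot[e,\mathrm{inr}]$ with $\mathrm{can}=[H\mathrm{inl},H\mathrm{inr}]$. A complete Elgot algebra is an $H$-algebra with an assignment $e\mapsto e^\dagger$ of a solution to every flat equation morphism that is functorial ($e^\dagger=f^\dagger\cdot h$ whenever $(Hh+\mathrm{id}_A)\cdot e=f\cdot h$) and compositional ($(f^\dagger\bullet e)^\dagger=(f\oplus e)^\dagger\cdot\mathrm{inl}$). A morphism $h:A\to B$ of complete Elgot algebras $(A,\alpha,(-)^\dagger)$, $(B,\beta,(-)^\ddagger)$ is solution-preserving if $h\cdot e^\dagger=(h\bullet e)^\ddagger$ for all flat equation morphisms $e$ in $A$. A free complete Elgot algebra on $Y$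 is a complete Elgot algebra $TY$ with a morphism $\eta_Y:Y\to TY$ such that for every complete Elgot algebra $A$ and morphism $m:Y\to A$ there is a unique solution-preserving $h:TY\to A$ with $h\cdot\eta_Y=m$. *)

theory Defs
  imports Main
begin

text \<open>
  Composition is written in the usual order: \<open>g \<cdot>\<^bsub>C\<^esub> f\<close> is \<open>g\<close> after \<open>f\<close>.
  The operations are only meaningful on \<open>obj C\<close> and on (composable) elements of \<open>mor C\<close>.
\<close>

record ('o, 'm) cat =
  obj :: "'o set"
  mor :: "'m set"
  dom :: "'m \<Rightarrow> 'o"
  cod :: "'m \<Rightarrow> 'o"
  ident :: "'o \<Rightarrow> 'm"
  cmp :: "'m \<Rightarrow> 'm \<Rightarrow> 'm"  (infixl \<open>\<cdot>\<index>\<close> 70)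

definition hom :: "('o, 'm, 'z) cat_scheme \<Rightarrow> 'o \<Rightarrow> 'o \<Rightarrow> 'm set" where
  "hom C X Y = {f \<in> mor C. dom C f = X \<and> cod C f = Y}"

locale category =
  fixes C :: "('o, 'm, 'z) cat_scheme" (structure)
  assumes dom_obj: "f \<in> mor C \<Longrightarrow> dom C f \<in> obj C"
    and cod_obj: "f \<in> mor C \<Longrightarrow> cod C f \<in> obj C"
    and ident_hom: "X \<in> obj C \<Longrightarrow> ident C X \<in> hom C X X"
    and cmp_hom: "f \<in> hom C X Y \<Longrightarrow> g \<in> hom C Y Z \<Longrightarrow> g \<cdot> f \<in> hom C X Z"
    and cmp_ident_left: "f \<in> hom C X Y \<Longrightarrow> ident C Y \<cdot> f = f"
    and cmp_ident_right: "f \<in> hom C X Y \<Longrightarrow> f \<cdot> ident C X = f"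
    and cmp_assoc: "f \<in> hom C W X \<Longrightarrow> g \<in> hom C X Y \<Longrightarrow> h \<in> hom C Y Z \<Longrightarrow>
      (h \<cdot> g) \<cdot> f = h \<cdot> (g \<cdot> f)"

definition is_coproduct ::
  "('o, 'm, 'z) cat_scheme \<Rightarrow> 'i set \<Rightarrow> ('i \<Rightarrow> 'o) \<Rightarrow> 'o \<Rightarrow> ('i \<Rightarrow> 'm) \<Rightarrow> bool" where
  "is_coproduct C I X S \<iota> \<longleftrightarrow>
     S \<in> obj C \<and> (\<forall>i\<in>I. \<iota> i \<in> hom C (X i) S) \<and>
     (\<forall>Z\<in>obj C. \<forall>f. (\<forall>i\<in>I. f i \<in> hom C (X i) Z) \<longrightarrow>
        (\<exists>!h. h \<in> hom C S Z \<and> (\<forall>i\<in>I. h \<cdot>\<^bsub>C\<^esub> \<iota> i = f i)))"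

definition has_finite_coproducts :: "('o, 'm, 'z) cat_scheme \<Rightarrow> bool" where
  "has_finite_coproducts C \<longleftrightarrow>
     (\<forall>(n::nat) X. (\<forall>i<n. X i \<in> obj C) \<longrightarrow> (\<exists>S \<iota>. is_coproduct C {..<n} X S \<iota>))"

definition is_binary_coproduct ::
  "('o, 'm, 'z) cat_scheme \<Rightarrow> 'o \<Rightarrow> 'o \<Rightarrow> 'o \<Rightarrow> 'm \<Rightarrow> 'm \<Rightarrow> bool" where
  "is_binary_coproduct C X Y S i j \<longleftrightarrow>
     S \<in> obj C \<and> i \<in> hom C X S \<and> j \<in> hom C Y S \<and>
     (\<forall>Z\<in>obj C. \<forall>f\<in>hom C X Z. \<forall>g\<in>hom C Y Z.
        \<exists>!h. h \<in> hom C S Z \<and> h \<cdot>\<^bsub>C\<^esub> i = f \<and> h \<cdot>\<^bsub>C\<^esub> j = g)"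

text \<open>
  The object \<open>X + Y\<close> is only determined up to isomorphism, so a category with finite
  coproducts is equipped with an arbitrary choice of binary coproducts.
\<close>

record ('o, 'm) cop_cat = "('o, 'm) cat" +
  plus_obj :: "'o \<Rightarrow> 'o \<Rightarrow> 'o"  (infixr \<open>\<amalg>\<index>\<close> 65)
  inl :: "'o \<Rightarrow> 'o \<Rightarrow> 'm"
  inr :: "'o \<Rightarrow> 'o \<Rightarrow> 'm"

locale category_with_finite_coproducts = category C
  for C :: "('o, 'm, 'z) cop_cat_scheme" (structure) +
  assumes finite_coproducts: "has_finite_coproducts C"
    and chosen_coproduct: "X \<in> obj C \<Longrightarrow> Y \<in> obj C \<Longrightarrow>
      is_binary_coproduct C X Y (X \<amalg> Y) (inl C X Y) (inr C X Y)"

definition copair :: "('o, 'm, 'z) cop_cat_scheme \<Rightarrow> 'm \<Rightarrow> 'm \<Rightarrow> 'm" where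
  "copair C f g = (THE h. h \<in> hom C (dom C f \<amalg>\<^bsub>C\<^esub> dom C g) (cod C f) \<and>
     h \<cdot>\<^bsub>C\<^esub> inl C (dom C f) (dom C g) = f \<and> h \<cdot>\<^bsub>C\<^esub> inr C (dom C f) (dom C g) = g)"

definition plus_mor :: "('o, 'm, 'z) cop_cat_scheme \<Rightarrow> 'm \<Rightarrow> 'm \<Rightarrow> 'm" where
  "plus_mor C f g = copair C (inl C (cod C f) (cod C g) \<cdot>\<^bsub>C\<^esub> f) (inr C (cod C f) (cod C g) \<cdot>\<^bsub>C\<^esub> g)"

text \<open>The canonical isomorphism \<open>X + (Y + Z) \<rightarrow> (X + Y) + Z\<close>.\<close>

definition cop_assoc :: "('o, 'm, 'z) cop_cat_scheme \<Rightarrow> 'o \<Rightarrow> 'o \<Rightarrow> 'o \<Rightarrow> 'm" where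
  "cop_assoc C X Y Z =
     copair C (inl C (X \<amalg>\<^bsub>C\<^esub> Y) Z \<cdot>\<^bsub>C\<^esub> inl C X Y)
       (copair C (inl C (X \<amalg>\<^bsub>C\<^esub> Y) Z \<cdot>\<^bsub>C\<^esub> inr C X Y) (inr C (X \<amalg>\<^bsub>C\<^esub> Y) Z))"

record ('o, 'm) endo =
  on_obj :: "'o \<Rightarrow> 'o"
  on_mor :: "'m \<Rightarrow> 'm"

definition is_endofunctor :: "('o, 'm, 'z) cat_scheme \<Rightarrow> ('o, 'm) endo \<Rightarrow> bool" where
  "is_endofunctor C F \<longleftrightarrow>
     (\<forall>X\<in>obj C. on_obj F X \<in> obj C \<and> on_mor F (ident C X) = ident C (on_obj F X)) \<and>
     (\<forall>X Y. \<forall>f\<in>hom C X Y. on_mor F f \<in> hom C (on_obj F X) (on_obj F Y)) \<and>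
     (\<forall>X Y Z. \<forall>f\<in>hom C X Y. \<forall>g\<in>hom C Y Z.
        on_mor F (g \<cdot>\<^bsub>C\<^esub> f) = on_mor F g \<cdot>\<^bsub>C\<^esub> on_mor F f)"

definition is_coalgebra :: "('o, 'm, 'z) cat_scheme \<Rightarrow> ('o, 'm) endo \<Rightarrow> 'o \<Rightarrow> 'm \<Rightarrow> bool" where
  "is_coalgebra C F X c \<longleftrightarrow> X \<in> obj C \<and> c \<in> hom C X (on_obj F X)"

definition is_coalgebra_hom ::
  "('o, 'm, 'z) cat_scheme \<Rightarrow> ('o, 'm) endo \<Rightarrow> 'o \<Rightarrow> 'm \<Rightarrow> 'o \<Rightarrow> 'm \<Rightarrow> 'm \<Rightarrow> bool" where
  "is_coalgebra_hom C F X c Z d h \<longleftrightarrow> h \<in> hom C X Z \<and> d \<cdot>\<^bsub>C\<^esub> h = on_mor F h \<cdot>\<^bsub>C\<^esub> c"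

definition is_final_coalgebra :: "('o, 'm, 'z) cat_scheme \<Rightarrow> ('o, 'm) endo \<Rightarrow> 'o \<Rightarrow> 'm \<Rightarrow> bool" where
  "is_final_coalgebra C F T t \<longleftrightarrow> is_coalgebra C F T t \<and>
     (\<forall>X c. is_coalgebra C F X c \<longrightarrow> (\<exists>!h. is_coalgebra_hom C F X c T t h))"

definition plus_functor :: "('o, 'm, 'z) cop_cat_scheme \<Rightarrow> ('o, 'm) endo \<Rightarrow> 'o \<Rightarrow> ('o, 'm) endo" where
  "plus_functor C H Y =
     \<lparr>on_obj = (\<lambda>X. on_obj H X \<amalg>\<^bsub>C\<^esub> Y), on_mor = (\<lambda>f. plus_mor C (on_mor H f) (ident C Y))\<rparr>"

text \<open>
  The morphisms \<open>X \<rightarrow> HX + A\<close>. An object \<open>A\<close> need not be determined by \<open>HX + A\<close>, hence it is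
  an explicit argument here and below, whereas \<open>X\<close> is recovered as the domain.
\<close>

definition flat_eqs :: "('o, 'm, 'z) cop_cat_scheme \<Rightarrow> ('o, 'm) endo \<Rightarrow> 'o \<Rightarrow> 'm set" where
  "flat_eqs C H A = {e \<in> mor C. cod C e = on_obj H (dom C e) \<amalg>\<^bsub>C\<^esub> A}"

definition is_solution ::
  "('o, 'm, 'z) cop_cat_scheme \<Rightarrow> ('o, 'm) endo \<Rightarrow> 'o \<Rightarrow> 'm \<Rightarrow> 'm \<Rightarrow> 'm \<Rightarrow> bool" where
  "is_solution C H A \<alpha> e s \<longleftrightarrow> s \<in> hom C (dom C e) A \<and>
     s = copair C \<alpha> (ident C A) \<cdot>\<^bsub>C\<^esub> plus_mor C (on_mor H s) (ident C A) \<cdot>\<^bsub>C\<^esub> e"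

text \<open>\<open>h \<bullet> e\<close> for \<open>e : X \<rightarrow> HX + Y\<close> and \<open>h : Y \<rightarrow> Z\<close>.\<close>

definition eq_rename :: "('o, 'm, 'z) cop_cat_scheme \<Rightarrow> ('o, 'm) endo \<Rightarrow> 'm \<Rightarrow> 'm \<Rightarrow> 'm" where
  "eq_rename C H h e = plus_mor C (ident C (on_obj H (dom C e))) h \<cdot>\<^bsub>C\<^esub> e"

definition can :: "('o, 'm, 'z) cop_cat_scheme \<Rightarrow> ('o, 'm) endo \<Rightarrow> 'o \<Rightarrow> 'o \<Rightarrow> 'm" where
  "can C H X Y = copair C (on_mor H (inl C X Y)) (on_mor H (inr C X Y))"

text \<open>
  The flat equation morphism \<open>f \<oplus> e : X + Y \<rightarrow> H(X + Y) + A\<close> for \<open>e : X \<rightarrow> HX + Y\<close> and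
  \<open>f : Y \<rightarrow> HY + A\<close>. The associativity isomorphism, usually left implicit, is the one
  \<open>HX + (HY + A) \<rightarrow> (HX + HY) + A\<close>.
\<close>

definition eq_combine :: "('o, 'm, 'z) cop_cat_scheme \<Rightarrow> ('o, 'm) endo \<Rightarrow> 'o \<Rightarrow> 'm \<Rightarrow> 'm \<Rightarrow> 'm" where
  "eq_combine C H A f e =
    (let X = dom C e; Y = dom C f; HX = on_obj H X; HY = on_obj H Y in
       plus_mor C (can C H X Y) (ident C A) \<cdot>\<^bsub>C\<^esub> cop_assoc C HX HY A \<cdot>\<^bsub>C\<^esub>
       plus_mor C (ident C HX) f \<cdot>\<^bsub>C\<^esub> copair C e (inr C HX Y))"

text \<open>The assignment \<open>sol\<close> is only relevant on \<open>flat_eqs C H A\<close>.\<close>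

definition is_complete_elgot ::
  "('o, 'm, 'z) cop_cat_scheme \<Rightarrow> ('o, 'm) endo \<Rightarrow> 'o \<Rightarrow> 'm \<Rightarrow> ('m \<Rightarrow> 'm) \<Rightarrow> bool" where
  "is_complete_elgot C H A \<alpha> sol \<longleftrightarrow>
     A \<in> obj C \<and> \<alpha> \<in> hom C (on_obj H A) A \<and>
     (\<forall>e\<in>flat_eqs C H A. is_solution C H A \<alpha> e (sol e)) \<and>
     (\<forall>e\<in>flat_eqs C H A. \<forall>f\<in>flat_eqs C H A. \<forall>h\<in>hom C (dom C e) (dom C f).
        plus_mor C (on_mor H h) (ident C A) \<cdot>\<^bsub>C\<^esub> e = f \<cdot>\<^bsub>C\<^esub> h \<longrightarrow> sol e = sol f \<cdot>\<^bsub>C\<^esub> h) \<and>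
     (\<forall>f\<in>flat_eqs C H A. \<forall>e\<in>flat_eqs C H (dom C f).
        sol (eq_rename C H (sol f) e) = sol (eq_combine C H A f e) \<cdot>\<^bsub>C\<^esub> inl C (dom C e) (dom C f))"

definition is_solution_preserving ::
  "('o, 'm, 'z) cop_cat_scheme \<Rightarrow> ('o, 'm) endo \<Rightarrow> 'o \<Rightarrow> ('m \<Rightarrow> 'm) \<Rightarrow> 'o \<Rightarrow> ('m \<Rightarrow> 'm) \<Rightarrow> 'm \<Rightarrow> bool" where
  "is_solution_preserving C H A sol B sol' h \<longleftrightarrow>
     h \<in> hom C A B \<and> (\<forall>e\<in>flat_eqs C H A. h \<cdot>\<^bsub>C\<^esub> sol e = sol' (eq_rename C H h e))"

definition is_free_complete_elgot ::
  "('o, 'm, 'z) cop_cat_scheme \<Rightarrow> ('o, 'm) endo \<Rightarrow> 'o \<Rightarrow> 'o \<Rightarrow> 'm \<Rightarrow> ('m \<Rightarrow> 'm) \<Rightarrow> 'm \<Rightarrow> bool" where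
  "is_free_complete_elgot C H Y T \<tau> sol \<eta> \<longleftrightarrow>
     is_complete_elgot C H T \<tau> sol \<and> \<eta> \<in> hom C Y T \<and>
     (\<forall>A \<alpha> sol' m. is_complete_elgot C H A \<alpha> sol' \<and> m \<in> hom C Y A \<longrightarrow>
        (\<exists>!h. is_solution_preserving C H T sol A sol' h \<and> h \<cdot>\<^bsub>C\<^esub> \<eta> = m))"

end

theory Submission
  imports Defs
begin

text \<open>
  The link between both notions is this: if \<open>s\<close> solves \<open>e : X \<rightarrow> HX + T\<close> in an algebra \<open>\<tau>\<close>, and
  \<open>f : T \<rightarrow> HT + A\<close> satisfies \<open>f \<cdot> \<tau> = inl\<close>, then \<open>[s, id]\<close> is a morphism of equations from
  \<open>f \<oplus> e\<close> to \<open>f\<close>.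

  Suppose first that \<open>[\<tau>, \<eta>]\<close> is inverse to \<open>t : T \<rightarrow> HT + Y\<close>. If \<open>A\<close> is a complete Elgot algebra
  and \<open>m : Y \<rightarrow> A\<close>, then taking \<open>f = m \<bullet> t\<close> above and using functoriality and compositionality shows
  that the solution of \<open>m \<bullet> t\<close> preserves solutions; it extends \<open>m\<close> along \<open>\<eta>\<close>.

  If \<open>t\<close> is final, it is invertible by Lambek's lemma, and taking \<open>f = t\<close> shows that flat equations
  in \<open>T\<close> have unique solutions, which makes \<open>T\<close> a complete Elgot algebra. The identity is the
  solution of \<open>\<eta> \<bullet> t\<close>, so the only solution-preserving extension of \<open>m\<close> is the solution of
  \<open>m \<bullet> t\<close>.

  If \<open>T\<close> is free, then \<open>HT + Y\<close> is a complete Elgot algebra for which \<open>[\<tau>, \<eta>]\<close> preserves solutions,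
  so a Lambek-style argument makes \<open>[\<tau>, \<eta>]\<close> invertible with some inverse \<open>t\<close>. For a coalgebra \<open>c\<close>
  the solution of \<open>\<eta> \<bullet> c\<close> is a homomorphism to \<open>t\<close>. By functoriality any homomorphism \<open>h\<close>, composed
  with the solution of \<open>\<eta> \<bullet> t\<close>, yields that solution; and the solution of \<open>\<eta> \<bullet> t\<close> is a
  solution-preserving extension of \<open>\<eta>\<close>, hence the identity.
\<close>

section \<open>Calculation rules for composition, copairings and the endofunctor\<close>

locale cat_with_endo = category_with_finite_coproducts C
  for C :: "('o, 'm, 'z) cop_cat_scheme" (structure) +
  fixes H :: "('o, 'm) endo"
  assumes endo: "is_endofunctor C H"
begin

declare dom_obj [simp] cod_obj [simp]

lemma ident_simps [simp]:
  assumes "X \<in> obj C"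
  shows "ident C X \<in> mor C" "dom C (ident C X) = X" "cod C (ident C X) = X"
  using ident_hom [OF assms] by (auto simp: hom_def)

text \<open>Typing is expressed through \<open>dom\<close> and \<open>cod\<close> instead of
  \<open>hom\<close>, so that the simplifier can compute the type of any composite.\<close>

lemma cmp_simps [simp]:
  assumes "f \<in> mor C" "g \<in> mor C" "cod C f = dom C g"
  shows "g \<cdot> f \<in> mor C" "dom C (g \<cdot> f) = dom C f" "cod C (g \<cdot> f) = cod C g"
  using cmp_hom [of f "dom C f" "dom C g" g "cod C g"] assms by (auto simp: hom_def)

lemma ident_cmp [simp]: "f \<in> mor C \<Longrightarrow> cod C f = Y \<Longrightarrow> ident C Y \<cdot> f = f"
  using cmp_ident_left [of f "dom C f" Y] by (auto simp: hom_def)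

lemma cmp_ident [simp]: "f \<in> mor C \<Longrightarrow> dom C f = X \<Longrightarrow> f \<cdot> ident C X = f"
  using cmp_ident_right [of f X "cod C f"] by (auto simp: hom_def)

lemma assoc [simp]:
  assumes "f \<in> mor C" "g \<in> mor C" "h \<in> mor C" "cod C f = dom C g" "cod C g = dom C h"
  shows "(h \<cdot> g) \<cdot> f = h \<cdot> (g \<cdot> f)"
  using cmp_assoc [of f "dom C f" "dom C g" g "dom C h" h "cod C h"] assms
  by (auto simp: hom_def)

lemma inl_inr_simps [simp]:
  assumes "X \<in> obj C" "Y \<in> obj C"
  shows "X \<amalg> Y \<in> obj C"
    "inl C X Y \<in> mor C" "dom C (inl C X Y) = X" "cod C (inl C X Y) = X \<amalg> Y"
    "inr C X Y \<in> mor C" "dom C (inr C X Y) = Y" "cod C (inr C X Y) = X \<amalg> Y"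
  using chosen_coproduct [OF assms] by (auto simp: is_binary_coproduct_def hom_def)

lemma copair_ex1:
  assumes "f \<in> mor C" "g \<in> mor C" "cod C f = cod C g"
  shows "\<exists>!h. h \<in> hom C (dom C f \<amalg> dom C g) (cod C f) \<and>
     h \<cdot> inl C (dom C f) (dom C g) = f \<and> h \<cdot> inr C (dom C f) (dom C g) = g"
proof -
  have "\<forall>Z\<in>obj C. \<forall>f'\<in>hom C (dom C f) Z. \<forall>g'\<in>hom C (dom C g) Z.
      \<exists>!h. h \<in> hom C (dom C f \<amalg> dom C g) Z \<and> h \<cdot> inl C (dom C f) (dom C g) = f' \<and>
        h \<cdot> inr C (dom C f) (dom C g) = g'"
    using chosen_coproduct [of "dom C f" "dom C g"] assms
    by (simp add: is_binary_coproduct_def)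
  moreover have "f \<in> hom C (dom C f) (cod C f)" "g \<in> hom C (dom C g) (cod C f)"
    using assms by (auto simp: hom_def)
  ultimately show ?thesis
    using cod_obj assms by blast
qed

lemma copair_props:
  assumes "f \<in> mor C" "g \<in> mor C" "cod C f = cod C g"
  shows "copair C f g \<in> hom C (dom C f \<amalg> dom C g) (cod C f) \<and>
     copair C f g \<cdot> inl C (dom C f) (dom C g) = f \<and>
     copair C f g \<cdot> inr C (dom C f) (dom C g) = g"
  unfolding copair_def by (rule theI') (rule copair_ex1 [OF assms])

lemma copair_simps [simp]:
  assumes "f \<in> mor C" "g \<in> mor C" "cod C f = cod C g"
  shows "copair C f g \<in> mor C" "dom C (copair C f g) = dom C f \<amalg> dom C g"
    "cod C (copair C f g) = cod C f"
    "dom C f = X \<Longrightarrow> dom C g = Y \<Longrightarrow> copair C f g \<cdot> inl C X Y = f"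
    "dom C f = X \<Longrightarrow> dom C g = Y \<Longrightarrow> copair C f g \<cdot> inr C X Y = g"
  using copair_props [OF assms] by (auto simp: hom_def)

text \<open>Since \<open>assoc\<close> nests composites to the right, an injection following a
  copairing may carry a further morphism \<open>k\<close>; this form lets the two still
  cancel.\<close>

lemma copair_cmp_inl [simp]:
  assumes "f \<in> mor C" "g \<in> mor C" "cod C f = cod C g" "dom C f = X" "dom C g = Y"
    "k \<in> mor C" "cod C k = X"
  shows "copair C f g \<cdot> (inl C X Y \<cdot> k) = f \<cdot> k"
  using assms assoc [of k "inl C X Y" "copair C f g"] by (auto simp del: assoc)

lemma copair_cmp_inr [simp]:
  assumes "f \<in> mor C" "g \<in> mor C" "cod C f = cod C g" "dom C f = X" "dom C g = Y"
    "k \<in> mor C" "cod C k = Y"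
  shows "copair C f g \<cdot> (inr C X Y \<cdot> k) = g \<cdot> k"
  using assms assoc [of k "inr C X Y" "copair C f g"] by (auto simp del: assoc)

text \<open>Both morphisms are the unique copairing of their common restrictions to the two
  summands.\<close>

lemma coproduct_ext:
  assumes "u \<in> mor C" "v \<in> mor C" "X \<in> obj C" "Y \<in> obj C"
    and "dom C u = X \<amalg> Y" "dom C v = X \<amalg> Y" "cod C u = cod C v"
    and "u \<cdot> inl C X Y = v \<cdot> inl C X Y" "u \<cdot> inr C X Y = v \<cdot> inr C X Y"
  shows "u = v"
  using copair_ex1 [of "u \<cdot> inl C X Y" "u \<cdot> inr C X Y"] assms
  by (auto simp: hom_def)

lemma copair_inl_inr [simp]:
  "X \<in> obj C \<Longrightarrow> Y \<in> obj C \<Longrightarrow> copair C (inl C X Y) (inr C X Y) = ident C (X \<amalg> Y)"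
  by (rule coproduct_ext [of _ _ X Y]) auto

lemma cmp_copair [simp]:
  assumes "f \<in> mor C" "g \<in> mor C" "cod C f = cod C g" "h \<in> mor C" "cod C f = dom C h"
  shows "h \<cdot> copair C f g = copair C (h \<cdot> f) (h \<cdot> g)"
  by (rule coproduct_ext [of _ _ "dom C f" "dom C g"]) (use assms in auto)

lemma cmp_copair_cmp [simp]:
  assumes "f \<in> mor C" "g \<in> mor C" "cod C f = cod C g" "h \<in> mor C" "cod C f = dom C h"
    "k \<in> mor C" "cod C k = dom C f \<amalg> dom C g"
  shows "h \<cdot> (copair C f g \<cdot> k) = copair C (h \<cdot> f) (h \<cdot> g) \<cdot> k"
  using assms assoc [of k "copair C f g" h] by (simp del: assoc)

lemma H_obj [simp]: "X \<in> obj C \<Longrightarrow> on_obj H X \<in> obj C"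
  and H_ident [simp]: "X \<in> obj C \<Longrightarrow> on_mor H (ident C X) = ident C (on_obj H X)"
  using endo by (auto simp: is_endofunctor_def)

lemma H_mor [simp]:
  assumes "f \<in> mor C"
  shows "on_mor H f \<in> mor C" "dom C (on_mor H f) = on_obj H (dom C f)"
    "cod C (on_mor H f) = on_obj H (cod C f)"
proof -
  have "f \<in> hom C (dom C f) (cod C f)" using assms by (auto simp: hom_def)
  then have "on_mor H f \<in> hom C (on_obj H (dom C f)) (on_obj H (cod C f))"
    using endo unfolding is_endofunctor_def by blast
  then show "on_mor H f \<in> mor C" "dom C (on_mor H f) = on_obj H (dom C f)"
    "cod C (on_mor H f) = on_obj H (cod C f)"
    by (auto simp: hom_def)
qed

lemma H_cmp:
  assumes "f \<in> mor C" "g \<in> mor C" "cod C f = dom C g"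
  shows "on_mor H (g \<cdot> f) = on_mor H g \<cdot> on_mor H f"
proof -
  have "f \<in> hom C (dom C f) (dom C g)" "g \<in> hom C (dom C g) (cod C g)"
    using assms by (auto simp: hom_def)
  then show ?thesis
    using endo unfolding is_endofunctor_def by blast
qed

section \<open>Normal forms for flat equation morphisms\<close>

lemma flat_eqs_iff [simp]:
  "e \<in> flat_eqs C H A \<longleftrightarrow> e \<in> mor C \<and> cod C e = on_obj H (dom C e) \<amalg> A"
  by (simp add: flat_eqs_def)

text \<open>Turns renaming into a copairing, on which \<open>cmp_copair\<close> can compute. Many
  proofs below remove the rule so that a renamed equation stays intact as an argument of
  \<open>sol\<close>.\<close>

lemma eq_rename_eq [simp]:
  assumes "e \<in> mor C" "cod C e = on_obj H (dom C e) \<amalg> A" "h \<in> mor C" "dom C h = A"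
  shows "eq_rename C H h e =
    copair C (inl C (on_obj H (dom C e)) (cod C h)) (inr C (on_obj H (dom C e)) (cod C h) \<cdot> h) \<cdot> e"
  using assms by (simp add: eq_rename_def plus_mor_def)

text \<open>Multiplying out \<open>can\<close> and the associativity isomorphism: on
  \<open>Y\<close> one gets \<open>f\<close> with \<open>HY\<close> moved into
  \<open>H(X + Y)\<close>; on \<open>X\<close> one gets \<open>e\<close>, with its parameters in
  \<open>Y\<close> replaced by the former.\<close>

lemma eq_combine_eq:
  assumes "f \<in> mor C" "cod C f = on_obj H (dom C f) \<amalg> A" "A \<in> obj C"
    and "e \<in> mor C" "cod C e = on_obj H (dom C e) \<amalg> dom C f"
    and "X = dom C e" "Y = dom C f" "Q = on_obj H (X \<amalg> Y)"
  shows "eq_combine C H A f e =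
    copair C
      (copair C (inl C Q A \<cdot> on_mor H (inl C X Y))
         (copair C (inl C Q A \<cdot> on_mor H (inr C X Y)) (inr C Q A) \<cdot> f) \<cdot> e)
      (copair C (inl C Q A \<cdot> on_mor H (inr C X Y)) (inr C Q A) \<cdot> f)"
  using assms by (simp add: eq_combine_def plus_mor_def can_def cop_assoc_def Let_def)

lemma is_solution_iff:
  assumes "A \<in> obj C" "\<alpha> \<in> mor C" "dom C \<alpha> = on_obj H A" "cod C \<alpha> = A"
    and "e \<in> mor C" "cod C e = on_obj H (dom C e) \<amalg> A"
  shows "is_solution C H A \<alpha> e s \<longleftrightarrow>
    s \<in> mor C \<and> dom C s = dom C e \<and> cod C s = A \<and>
    s = copair C (\<alpha> \<cdot> on_mor H s) (ident C A) \<cdot> e"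
  using assms by (auto simp: is_solution_def hom_def plus_mor_def)

text \<open>Morphisms of equations and solution equations both compose \<open>f \<oplus> e\<close>
  with a copairing, so this one computation serves both.\<close>

lemma copair_cmp_eq_combine:
  assumes "f \<in> mor C" "cod C f = on_obj H (dom C f) \<amalg> A" "A \<in> obj C"
    and "e \<in> mor C" "cod C e = on_obj H (dom C e) \<amalg> dom C f"
    and "k \<in> mor C" "dom C k = on_obj H (dom C e \<amalg> dom C f)"
    and "g \<in> mor C" "dom C g = A" "cod C k = cod C g"
  shows "copair C k g \<cdot> eq_combine C H A f e =
    copair C
      (copair C (k \<cdot> on_mor H (inl C (dom C e) (dom C f)))
         (copair C (k \<cdot> on_mor H (inr C (dom C e) (dom C f))) g \<cdot> f) \<cdot> e)
      (copair C (k \<cdot> on_mor H (inr C (dom C e) (dom C f))) g \<cdot> f)"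
  using assms by (simp add: eq_combine_eq)

lemma eq_combine_mor [simp]:
  assumes "f \<in> mor C" "cod C f = on_obj H (dom C f) \<amalg> A" "A \<in> obj C"
    and "e \<in> mor C" "cod C e = on_obj H (dom C e) \<amalg> dom C f"
  shows "eq_combine C H A f e \<in> mor C"
    "dom C (eq_combine C H A f e) = dom C e \<amalg> dom C f"
    "cod C (eq_combine C H A f e) = on_obj H (dom C e \<amalg> dom C f) \<amalg> A"
  using assms by (simp_all add: eq_combine_eq)

end

section \<open>Complete Elgot algebras and combined equations\<close>

lemma is_complete_elgotD:
  assumes "is_complete_elgot C H A \<alpha> sol"
  shows "A \<in> obj C" "\<alpha> \<in> mor C" "dom C \<alpha> = on_obj H A" "cod C \<alpha> = A"
    and "e \<in> flat_eqs C H A \<Longrightarrow> is_solution C H A \<alpha> e (sol e)"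
    and "e \<in> flat_eqs C H A \<Longrightarrow> f \<in> flat_eqs C H A \<Longrightarrow> h \<in> hom C (dom C e) (dom C f) \<Longrightarrow>
      plus_mor C (on_mor H h) (ident C A) \<cdot>\<^bsub>C\<^esub> e = f \<cdot>\<^bsub>C\<^esub> h \<Longrightarrow> sol e = sol f \<cdot>\<^bsub>C\<^esub> h"
    and "f \<in> flat_eqs C H A \<Longrightarrow> e \<in> flat_eqs C H (dom C f) \<Longrightarrow>
      sol (eq_rename C H (sol f) e) = sol (eq_combine C H A f e) \<cdot>\<^bsub>C\<^esub> inl C (dom C e) (dom C f)"
  using assms by (auto simp: is_complete_elgot_def hom_def)

lemma is_free_complete_elgotD:
  assumes "is_free_complete_elgot C H Y T \<tau> sol \<eta>"
  shows "is_complete_elgot C H T \<tau> sol" "\<eta> \<in> hom C Y T"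
    and "is_complete_elgot C H A \<alpha> sol' \<Longrightarrow> m \<in> hom C Y A \<Longrightarrow>
      \<exists>!h. is_solution_preserving C H T sol A sol' h \<and> h \<cdot>\<^bsub>C\<^esub> \<eta> = m"
  using assms unfolding is_free_complete_elgot_def by blast+

context cat_with_endo
begin

text \<open>On the variables of \<open>f\<close> the combined equation is a copy of
  \<open>f\<close>, so \<open>inr\<close> is a morphism of equations. Functoriality then fixes the
  solution of \<open>f \<oplus> e\<close> on this summand.\<close>

lemma eq_combine_hom_inr:
  assumes "f \<in> mor C" "cod C f = on_obj H (dom C f) \<amalg> A" "A \<in> obj C"
    and "e \<in> mor C" "cod C e = on_obj H (dom C e) \<amalg> dom C f"
  shows "plus_mor C (on_mor H (inr C (dom C e) (dom C f))) (ident C A) \<cdot> f =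
    eq_combine C H A f e \<cdot> inr C (dom C e) (dom C f)"
  using assms by (simp add: eq_combine_eq plus_mor_def)

lemma H_copair_inl:
  assumes "f \<in> mor C" "g \<in> mor C" "cod C f = cod C g" "dom C f = X" "dom C g = Y"
  shows "on_mor H (copair C f g) \<cdot> on_mor H (inl C X Y) = on_mor H f"
    "on_mor H (copair C f g) \<cdot> on_mor H (inr C X Y) = on_mor H g"
  using assms by (auto simp: H_cmp [symmetric])

text \<open>One side of the condition that \<open>[s, id]\<close> is a morphism of equations from
  \<open>f \<oplus> e\<close> to \<open>f\<close>. The other side is
  \<open>[f \<cdot> s, f]\<close>, so only the first components remain to be compared.\<close>

lemma eq_combine_sol_hom:
  assumes A: "A \<in> obj C" and T: "T \<in> obj C"
    and f: "f \<in> mor C" "dom C f = T" "cod C f = on_obj H T \<amalg> A"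
    and e: "e \<in> mor C" "cod C e = on_obj H (dom C e) \<amalg> T"
    and s: "s \<in> mor C" "dom C s = dom C e" "cod C s = T"
  shows "plus_mor C (on_mor H (copair C s (ident C T))) (ident C A) \<cdot> eq_combine C H A f e =
    copair C (copair C (inl C (on_obj H T) A \<cdot> on_mor H s) f \<cdot> e) f"
  using assms by (simp add: plus_mor_def copair_cmp_eq_combine H_copair_inl)

end

locale elgot_algebra = cat_with_endo C H
  for C :: "('o, 'm, 'z) cop_cat_scheme" (structure) and H :: "('o, 'm) endo" +
  fixes A :: 'o and \<alpha> :: 'm and sol :: "'m \<Rightarrow> 'm"
  assumes elgot: "is_complete_elgot C H A \<alpha> sol"
begin

lemmas alg_simps [simp] = is_complete_elgotD(1-4) [OF elgot]

lemma sol_simps [simp]: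
  assumes "e \<in> mor C" "cod C e = on_obj H (dom C e) \<amalg> A"
  shows "sol e \<in> mor C" "dom C (sol e) = dom C e" "cod C (sol e) = A"
  using is_complete_elgotD(5) [OF elgot, of e] assms by (auto simp: is_solution_def hom_def)

lemma sol_eq:
  assumes "e \<in> mor C" "cod C e = on_obj H (dom C e) \<amalg> A"
  shows "copair C (\<alpha> \<cdot> on_mor H (sol e)) (ident C A) \<cdot> e = sol e"
  using is_complete_elgotD(5) [OF elgot, of e] assms is_solution_iff [of A \<alpha> e "sol e"] by simp

lemma sol_functorial:
  assumes "e \<in> mor C" "cod C e = on_obj H (dom C e) \<amalg> A"
    and "f \<in> mor C" "cod C f = on_obj H (dom C f) \<amalg> A"
    and "h \<in> mor C" "dom C h = dom C e" "cod C h = dom C f"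
    and "plus_mor C (on_mor H h) (ident C A) \<cdot> e = f \<cdot> h"
  shows "sol e = sol f \<cdot> h"
  using is_complete_elgotD(6) [OF elgot, of e f h] assms by (simp add: hom_def)

lemma sol_compositional:
  assumes "f \<in> mor C" "cod C f = on_obj H (dom C f) \<amalg> A"
    and "e \<in> mor C" "cod C e = on_obj H (dom C e) \<amalg> dom C f"
  shows "sol (eq_rename C H (sol f) e) = sol (eq_combine C H A f e) \<cdot> inl C (dom C e) (dom C f)"
  using is_complete_elgotD(7) [OF elgot, of f e] assms by simp

lemma sol_eq_combine_inr:
  assumes "f \<in> mor C" "cod C f = on_obj H (dom C f) \<amalg> A"
    and "e \<in> mor C" "cod C e = on_obj H (dom C e) \<amalg> dom C f"
  shows "sol (eq_combine C H A f e) \<cdot> inr C (dom C e) (dom C f) = sol f"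
  by (rule sol_functorial [symmetric]) (use assms in \<open>auto simp: eq_combine_hom_inr\<close>)

text \<open>Applying \<open>f\<close> to the solution equation of \<open>s\<close> and using
  \<open>f \<cdot> \<tau> = inl\<close> makes \<open>[s, id]\<close> a morphism from
  \<open>f \<oplus> e\<close> to \<open>f\<close>. Functoriality gives
  \<open>sol f \<cdot> [s, id]\<close> as the solution of \<open>f \<oplus> e\<close>, and
  compositionality identifies its restriction along \<open>inl\<close>.\<close>

lemma sol_combine_preserving:
  assumes T: "T \<in> obj C"
    and tau: "\<tau> \<in> mor C" "dom C \<tau> = on_obj H T" "cod C \<tau> = T"
    and f: "f \<in> mor C" "dom C f = T" "cod C f = on_obj H T \<amalg> A"
    and f_tau: "f \<cdot> \<tau> = inl C (on_obj H T) A"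
    and e: "e \<in> mor C" "cod C e = on_obj H (dom C e) \<amalg> T"
    and s: "is_solution C H T \<tau> e s"
  shows "sol f \<cdot> s = sol (eq_rename C H (sol f) e)"
proof -
  have s': "s \<in> mor C" "dom C s = dom C e" "cod C s = T"
    and s_eq: "s = copair C (\<tau> \<cdot> on_mor H s) (ident C T) \<cdot> e"
    using s is_solution_iff [OF T tau e] by auto
  have "f \<cdot> s = f \<cdot> (copair C (\<tau> \<cdot> on_mor H s) (ident C T) \<cdot> e)"
    using s_eq by simp
  also have "\<dots> = copair C ((f \<cdot> \<tau>) \<cdot> on_mor H s) f \<cdot> e"
    using T tau f e s' by simp
  finally have fs: "f \<cdot> s = copair C (inl C (on_obj H T) A \<cdot> on_mor H s) f \<cdot> e"
    by (simp add: f_tau)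
  have "sol (eq_combine C H A f e) = sol f \<cdot> copair C s (ident C T)"
    by (rule sol_functorial) (use T f e s' fs in \<open>simp_all add: eq_combine_sol_hom\<close>)
  then show ?thesis
    using T f e s' by (simp add: sol_compositional del: eq_rename_eq)
qed

end

section \<open>Solution-preserving morphisms\<close>

lemma (in elgot_algebra) solution_preserving_ident:
  "is_solution_preserving C H A sol A sol (ident C A)"
  unfolding is_solution_preserving_def by (simp add: hom_def)

locale two_elgot_algebras = A: elgot_algebra C H A \<alpha> sol + B: elgot_algebra C H B \<beta> sol'
  for C :: "('o, 'm, 'z) cop_cat_scheme" (structure) and H :: "('o, 'm) endo"
    and A \<alpha> sol B \<beta> sol'
begin

text \<open>The solution of \<open>H inr + id : HA + A \<rightarrow> H(HA + A) + A\<close> is \<open>[\<alpha>, id]\<close>.\<close>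

lemma solution_preserving_hom:
  assumes "is_solution_preserving C H A sol B sol' h"
  shows "h \<cdot> \<alpha> = \<beta> \<cdot> on_mor H h"
proof -
  have h: "h \<in> mor C" "dom C h = A" "cod C h = B"
    using assms by (auto simp: is_solution_preserving_def hom_def)
  let ?X = "on_obj H A \<amalg> A"
  let ?HX = "on_obj H ?X"
  define e where "e = copair C (inl C ?HX A \<cdot> on_mor H (inr C (on_obj H A) A)) (inr C ?HX A)"
  \<comment> \<open>This is \<open>e\<close> renamed along \<open>h\<close>. Unfolding its solution
    in \<open>B\<close> gives \<open>[\<beta> \<cdot> Hh, h]\<close>, whose left component is
    compared with that of \<open>h \<cdot> [\<alpha>, id]\<close>.\<close>
  define e' where "e' = copair C (inl C ?HX B \<cdot> on_mor H (inr C (on_obj H A) A)) (inr C ?HX B \<cdot> h)"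
  have e: "e \<in> mor C" "dom C e = ?X" "cod C e = ?HX \<amalg> A"
    by (simp_all add: e_def)
  have e': "e' \<in> mor C" "dom C e' = ?X" "cod C e' = ?HX \<amalg> B"
    using h by (simp_all add: e'_def)
  have ren: "eq_rename C H h e = e'"
    using h e by (simp, simp add: e_def e'_def)
  have pres: "h \<cdot> sol e = sol' e'"
    using assms e ren unfolding is_solution_preserving_def by (simp del: A.eq_rename_eq)
  note se = A.sol_eq [of e] and se' = B.sol_eq [of e']
  have r: "sol e \<cdot> inr C (on_obj H A) A = ident C A"
    using e by (subst se [symmetric]) (simp_all, simp add: e_def)
  have l: "sol e \<cdot> inl C (on_obj H A) A = \<alpha> \<cdot> on_mor H (sol e \<cdot> inr C (on_obj H A) A)"
    using e by (subst se [symmetric]) (simp_all add: A.H_cmp, simp add: e_def)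
  have r': "sol' e' \<cdot> inr C (on_obj H A) A = h"
    using e' h by (subst se' [symmetric]) (simp_all, simp add: e'_def)
  have l': "sol' e' \<cdot> inl C (on_obj H A) A = \<beta> \<cdot> on_mor H (sol' e' \<cdot> inr C (on_obj H A) A)"
    using e' h by (subst se' [symmetric]) (simp_all add: A.H_cmp, simp add: e'_def)
  have "h \<cdot> \<alpha> = h \<cdot> (sol e \<cdot> inl C (on_obj H A) A)"
    using l r by simp
  also have "\<dots> = (h \<cdot> sol e) \<cdot> inl C (on_obj H A) A"
    using e h by simp
  also have "\<dots> = \<beta> \<cdot> on_mor H h"
    using pres l' r' by simp
  finally show ?thesis .
qed

end


context cat_with_endo
begin

lemma eq_rename_mor [simp]:
  assumes "e \<in> mor C" "cod C e = on_obj H (dom C e) \<amalg> A" "h \<in> mor C" "dom C h = A"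
  shows "eq_rename C H h e \<in> mor C" "dom C (eq_rename C H h e) = dom C e"
    "cod C (eq_rename C H h e) = on_obj H (dom C e) \<amalg> cod C h"
  using assms by simp_all

lemma eq_rename_cmp:
  assumes "e \<in> mor C" "cod C e = on_obj H (dom C e) \<amalg> A"
    "h \<in> mor C" "dom C h = A" "g \<in> mor C" "dom C g = cod C h"
  shows "eq_rename C H (g \<cdot> h) e = eq_rename C H g (eq_rename C H h e)"
  using assms by simp

text \<open>Renaming acts on the parameters only, and the parameters of \<open>f \<oplus> e\<close>
  are those of \<open>f\<close>.\<close>

lemma eq_combine_rename:
  assumes "h \<in> mor C"
    and "f \<in> mor C" "cod C f = on_obj H (dom C f) \<amalg> dom C h"
    and "e \<in> mor C" "cod C e = on_obj H (dom C e) \<amalg> dom C f"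
  shows "eq_combine C H (cod C h) (eq_rename C H h f) e =
    eq_rename C H h (eq_combine C H (dom C h) f e)"
  using assms by (simp add: eq_combine_eq)

text \<open>The last assumption supplies the type of \<open>sol e\<close>, which
  \<open>is_solution_preserving\<close> leaves open and which associativity requires.\<close>

lemma solution_preserving_cmp:
  assumes "is_solution_preserving C H A sol B sol' h" "is_solution_preserving C H B sol' D sol'' g"
    and "\<And>e. e \<in> flat_eqs C H A \<Longrightarrow> sol e \<in> hom C (dom C e) A"
  shows "is_solution_preserving C H A sol D sol'' (g \<cdot> h)"
proof -
  have h: "h \<in> mor C" "dom C h = A" "cod C h = B"
    and g: "g \<in> mor C" "dom C g = B" "cod C g = D"
    using assms(1,2) by (auto simp: is_solution_preserving_def hom_def)
  have "(g \<cdot> h) \<cdot> sol e = sol'' (eq_rename C H (g \<cdot> h) e)" if "e \<in> flat_eqs C H A" for e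
  proof -
    have e: "e \<in> mor C" "cod C e = on_obj H (dom C e) \<amalg> A"
      using that by auto
    have "(g \<cdot> h) \<cdot> sol e = g \<cdot> (h \<cdot> sol e)"
      using assms(3) [OF that] h g by (auto simp: hom_def)
    also have "\<dots> = g \<cdot> sol' (eq_rename C H h e)"
      using assms(1) that by (simp add: is_solution_preserving_def del: flat_eqs_iff)
    also have "\<dots> = sol'' (eq_rename C H g (eq_rename C H h e))"
      using assms(2) e h by (simp add: is_solution_preserving_def del: eq_rename_eq)
    finally show ?thesis
      using e h g by (simp add: eq_rename_cmp del: eq_rename_eq)
  qed
  then show ?thesis
    using h g unfolding is_solution_preserving_def by (simp add: hom_def)
qed

text \<open>By uniqueness each axiom reduces to checking that its right-hand side solves the
  equation on the left: \<open>sol f \<cdot> h\<close> solves \<open>e\<close>, and the restriction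
  to \<open>X\<close> of the solution of \<open>f \<oplus> e\<close> solves
  \<open>sol f \<bullet> e\<close>.\<close>

lemma unique_solutions_elgot:
  assumes A: "A \<in> obj C" "\<alpha> \<in> mor C" "dom C \<alpha> = on_obj H A" "cod C \<alpha> = A"
    and ex1: "\<And>e. e \<in> flat_eqs C H A \<Longrightarrow> \<exists>!s. is_solution C H A \<alpha> e s"
  shows "is_complete_elgot C H A \<alpha> (\<lambda>e. THE s. is_solution C H A \<alpha> e s)"
proof -
  define sol where "sol = (\<lambda>e. THE s. is_solution C H A \<alpha> e s)"
  have sol: "is_solution C H A \<alpha> e (sol e)" if "e \<in> flat_eqs C H A" for e
    unfolding sol_def by (rule theI') (rule ex1 [OF that])
  have sol_unique: "sol e = s" if "e \<in> flat_eqs C H A" "is_solution C H A \<alpha> e s" for e s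
    using that ex1 sol by blast
  have sol_mor: "sol e \<in> mor C" "dom C (sol e) = dom C e" "cod C (sol e) = A"
    and sol_eq: "sol e = copair C (\<alpha> \<cdot> on_mor H (sol e)) (ident C A) \<cdot> e"
    if "e \<in> mor C" "cod C e = on_obj H (dom C e) \<amalg> A" for e
    using sol [of e] that is_solution_iff [OF A that] by auto
  have functorial: "sol e = sol f \<cdot> h"
    if e: "e \<in> mor C" "cod C e = on_obj H (dom C e) \<amalg> A"
      and f: "f \<in> mor C" "cod C f = on_obj H (dom C f) \<amalg> A"
      and h: "h \<in> mor C" "dom C h = dom C e" "cod C h = dom C f"
      and eq: "plus_mor C (on_mor H h) (ident C A) \<cdot> e = f \<cdot> h" for e f h
  proof -
    note sf = sol_mor [OF f]
    have "copair C (\<alpha> \<cdot> on_mor H (sol f \<cdot> h)) (ident C A) \<cdot> e =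
        copair C (\<alpha> \<cdot> on_mor H (sol f)) (ident C A) \<cdot> (plus_mor C (on_mor H h) (ident C A) \<cdot> e)"
      using A e f h sf by (simp add: plus_mor_def H_cmp)
    also have "\<dots> = (copair C (\<alpha> \<cdot> on_mor H (sol f)) (ident C A) \<cdot> f) \<cdot> h"
      using A e f h sf by (simp add: eq)
    also have "\<dots> = sol f \<cdot> h"
      by (simp add: sol_eq [OF f, symmetric])
    finally have "is_solution C H A \<alpha> e (sol f \<cdot> h)"
      using e f h sf by (simp add: is_solution_iff [OF A e])
    then show ?thesis
      using sol_unique e by simp
  qed
  have compositional:
    "sol (eq_rename C H (sol f) e) = sol (eq_combine C H A f e) \<cdot> inl C (dom C e) (dom C f)"
    if f: "f \<in> mor C" "cod C f = on_obj H (dom C f) \<amalg> A"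
      and e: "e \<in> mor C" "cod C e = on_obj H (dom C e) \<amalg> dom C f" for e f
  proof -
    let ?c = "eq_combine C H A f e"
    define u where "u = sol ?c"
    define ul where "ul = u \<cdot> inl C (dom C e) (dom C f)"
    note sf = sol_mor [OF f]
    have c: "?c \<in> mor C" "cod C ?c = on_obj H (dom C ?c) \<amalg> A" "dom C ?c = dom C e \<amalg> dom C f"
      using A f e by simp_all
    have u: "u \<in> mor C" "dom C u = dom C e \<amalg> dom C f" "cod C u = A"
      using sol_mor [OF c(1,2)] c(3) unfolding u_def by simp_all
    have ul: "ul \<in> mor C" "dom C ul = dom C e" "cod C ul = A"
      using u e f by (simp_all add: ul_def)
    have ur: "u \<cdot> inr C (dom C e) (dom C f) = sol f"
      unfolding u_def
      by (rule functorial [symmetric]) (use A c f e in \<open>simp_all add: eq_combine_hom_inr\<close>)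
    have Hur: "on_mor H u \<cdot> on_mor H (inr C (dom C e) (dom C f)) = on_mor H (sol f)"
      using u e f by (simp add: H_cmp [symmetric] ur)
    have Hul: "on_mor H u \<cdot> on_mor H (inl C (dom C e) (dom C f)) = on_mor H ul"
      using u e f by (simp add: H_cmp [symmetric] ul_def)
    \<comment> \<open>The solution equation of \<open>f \<oplus> e\<close>, with its
      \<open>Y\<close>-part already identified as \<open>sol f\<close>; its left component is the
      solution equation wanted for \<open>ul\<close>.\<close>
    have "u = copair C (copair C (\<alpha> \<cdot> on_mor H ul) (sol f) \<cdot> e) (sol f)"
      unfolding u_def
      by (subst sol_eq [OF c(1,2)], fold u_def)
        (use A c f e u in \<open>simp add: copair_cmp_eq_combine Hul Hur sol_eq [OF f, symmetric]\<close>)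
    then have "ul = copair C (copair C (\<alpha> \<cdot> on_mor H ul) (sol f) \<cdot> e) (sol f) \<cdot>
        inl C (dom C e) (dom C f)"
      by (simp add: ul_def)
    also have "\<dots> = copair C (\<alpha> \<cdot> on_mor H ul) (sol f) \<cdot> e"
      using A c f e u ul sf by simp
    finally have ul_eq: "ul = copair C (\<alpha> \<cdot> on_mor H ul) (sol f) \<cdot> e" .
    have "is_solution C H A \<alpha> (eq_rename C H (sol f) e) ul"
      by (subst is_solution_iff) (use A f e ul sf ul_eq in auto)
    then show ?thesis
      unfolding u_def [symmetric] ul_def [symmetric]
      by (intro sol_unique) (use A f e ul sf in auto)
  qed
  show ?thesis
    unfolding sol_def [symmetric] is_complete_elgot_def
    using A sol functorial compositional by (auto simp: hom_def simp del: eq_rename_eq)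
qed

section \<open>Coalgebras for \<open>H(-) + Y\<close> and Lambek's lemma\<close>

lemma coalgebra_iff:
  assumes "Y \<in> obj C"
  shows "is_coalgebra C (plus_functor C H Y) X c \<longleftrightarrow>
    c \<in> mor C \<and> dom C c = X \<and> cod C c = on_obj H X \<amalg> Y"
  using assms dom_obj [of c] by (auto simp: is_coalgebra_def plus_functor_def hom_def)

lemma coalgebra_hom_iff:
  "is_coalgebra_hom C (plus_functor C H Y) X c Z d h \<longleftrightarrow>
    h \<in> mor C \<and> dom C h = X \<and> cod C h = Z \<and> d \<cdot> h = plus_mor C (on_mor H h) (ident C Y) \<cdot> c"
  by (auto simp: is_coalgebra_hom_def plus_functor_def hom_def)

text \<open>Let \<open>u\<close> be the homomorphism to \<open>t\<close> from the coalgebra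
  \<open>Ht + id\<close> on \<open>HT + Y\<close>. Then \<open>u \<cdot> t\<close> is an
  endomorphism of the final coalgebra, hence the identity, and
  \<open>t \<cdot> u = H(u \<cdot> t) + id\<close> is the identity as well.\<close>

lemma final_coalgebra_inverse:
  assumes Y: "Y \<in> obj C" and final: "is_final_coalgebra C (plus_functor C H Y) T t"
  obtains u where "u \<in> mor C" "dom C u = on_obj H T \<amalg> Y" "cod C u = T"
    "t \<cdot> u = ident C (on_obj H T \<amalg> Y)" "u \<cdot> t = ident C T"
proof -
  have T: "T \<in> obj C"
    and t: "t \<in> mor C" "dom C t = T" "cod C t = on_obj H T \<amalg> Y"
    using final Y by (auto simp: is_final_coalgebra_def is_coalgebra_def plus_functor_def hom_def)
  let ?c = "plus_mor C (on_mor H t) (ident C Y)"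
  have "is_coalgebra C (plus_functor C H Y) (on_obj H T \<amalg> Y) ?c"
    using T Y t by (simp add: coalgebra_iff plus_mor_def)
  then obtain u where u: "u \<in> mor C" "dom C u = on_obj H T \<amalg> Y" "cod C u = T"
    and tu: "t \<cdot> u = plus_mor C (on_mor H u) (ident C Y) \<cdot> ?c"
    using final unfolding is_final_coalgebra_def coalgebra_hom_iff by blast
  have "t \<cdot> u = plus_mor C (on_mor H (u \<cdot> t)) (ident C Y)"
    using tu T Y t u by (simp add: plus_mor_def H_cmp)
  then have tu': "t \<cdot> u = copair C (inl C (on_obj H T) Y \<cdot> on_mor H (u \<cdot> t)) (inr C (on_obj H T) Y)"
    using T Y t u by (simp add: plus_mor_def)
  have "is_coalgebra_hom C (plus_functor C H Y) T t T t (u \<cdot> t)"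
    using T Y t u tu' assoc [of t u t] by (simp add: coalgebra_hom_iff plus_mor_def del: assoc)
  moreover have "is_coalgebra_hom C (plus_functor C H Y) T t T t (ident C T)"
    using T Y t by (simp add: coalgebra_hom_iff plus_mor_def)
  ultimately have ut: "u \<cdot> t = ident C T"
    using final unfolding is_final_coalgebra_def by blast
  then have "t \<cdot> u = ident C (on_obj H T \<amalg> Y)"
    using tu' T Y by simp
  with that u ut show thesis by blast
qed

end

section \<open>Coalgebra structures \<open>t\<close> with inverse
  \<open>[\<tau>, \<eta>]\<close>\<close>

locale iso_coalgebra = cat_with_endo C H
  for C :: "('o, 'm, 'z) cop_cat_scheme" (structure) and H :: "('o, 'm) endo" +
  fixes Y T :: 'o and t \<tau> \<eta> :: 'm
  assumes objs [simp]: "Y \<in> obj C" "T \<in> obj C"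
    and t [simp]: "t \<in> mor C" "dom C t = T" "cod C t = on_obj H T \<amalg> Y"
    and tau [simp]: "\<tau> \<in> mor C" "dom C \<tau> = on_obj H T" "cod C \<tau> = T"
    and eta [simp]: "\<eta> \<in> mor C" "dom C \<eta> = Y" "cod C \<eta> = T"
    and t_tau: "t \<cdot> \<tau> = inl C (on_obj H T) Y"
    and t_eta: "t \<cdot> \<eta> = inr C (on_obj H T) Y"
    and copair_t: "copair C \<tau> \<eta> \<cdot> t = ident C T"
begin

lemma t_cancel:
  assumes "u \<in> mor C" "v \<in> mor C" "cod C u = T" "cod C v = T" "dom C u = dom C v" "t \<cdot> u = t \<cdot> v"
  shows "u = v"
proof -
  have "u = (copair C \<tau> \<eta> \<cdot> t) \<cdot> u" using assms by (simp add: copair_t)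
  also have "\<dots> = copair C \<tau> \<eta> \<cdot> (t \<cdot> u)" using assms by simp
  also have "\<dots> = (copair C \<tau> \<eta> \<cdot> t) \<cdot> v" using assms by simp
  also have "\<dots> = v" using assms by (simp add: copair_t)
  finally show ?thesis .
qed

text \<open>As \<open>t\<close> is cancellable, the solution equation may be composed with
  \<open>t\<close>. By \<open>t \<cdot> \<tau> = inl\<close> it becomes the left component of the
  homomorphism equation for \<open>[s, id]\<close>; the right component reads
  \<open>t = t\<close>.\<close>

lemma solution_iff_coalgebra_hom:
  assumes e: "e \<in> mor C" "cod C e = on_obj H (dom C e) \<amalg> T"
    and s: "s \<in> mor C" "dom C s = dom C e" "cod C s = T"
  shows "is_solution C H T \<tau> e s \<longleftrightarrow>
    is_coalgebra_hom C (plus_functor C H Y) (dom C e \<amalg> T) (eq_combine C H Y t e) T t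
      (copair C s (ident C T))"
proof -
  let ?w = "copair C (inl C (on_obj H T) Y \<cdot> on_mor H s) t \<cdot> e"
  have "t \<cdot> (copair C (\<tau> \<cdot> on_mor H s) (ident C T) \<cdot> e) =
      copair C ((t \<cdot> \<tau>) \<cdot> on_mor H s) t \<cdot> e"
    using e s by simp
  then have w: "t \<cdot> (copair C (\<tau> \<cdot> on_mor H s) (ident C T) \<cdot> e) = ?w"
    by (simp add: t_tau)
  have "is_solution C H T \<tau> e s \<longleftrightarrow> s = copair C (\<tau> \<cdot> on_mor H s) (ident C T) \<cdot> e"
    using e s by (simp add: is_solution_iff)
  also have "\<dots> \<longleftrightarrow> t \<cdot> s = ?w"
    unfolding w [symmetric]
    by (rule iffI, erule arg_cong, rule t_cancel) (use e s in auto)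
  also have "\<dots> \<longleftrightarrow> copair C (t \<cdot> s) t = copair C ?w t"
  proof
    assume "copair C (t \<cdot> s) t = copair C ?w t"
    then have "copair C (t \<cdot> s) t \<cdot> inl C (dom C e) T = copair C ?w t \<cdot> inl C (dom C e) T"
      by simp
    then show "t \<cdot> s = ?w"
      using e s by simp
  qed simp
  also have "\<dots> \<longleftrightarrow> is_coalgebra_hom C (plus_functor C H Y) (dom C e \<amalg> T) (eq_combine C H Y t e) T t
      (copair C s (ident C T))"
    using e s by (simp add: coalgebra_hom_iff eq_combine_sol_hom)
  finally show ?thesis .
qed

text \<open>Finality provides exactly one homomorphism \<open>g\<close> from
  \<open>t \<oplus> e\<close> to \<open>t\<close>. Its restriction to \<open>T\<close> is an
  endomorphism of the final coalgebra, so \<open>g\<close> has the form \<open>[s, id]\<close> and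
  \<open>s\<close> is the unique solution.\<close>

lemma final_unique_solution:
  assumes final: "is_final_coalgebra C (plus_functor C H Y) T t"
    and "e \<in> flat_eqs C H T"
  shows "\<exists>!s. is_solution C H T \<tau> e s"
proof -
  let ?hom = "is_coalgebra_hom C (plus_functor C H Y) (dom C e \<amalg> T) (eq_combine C H Y t e) T t"
  have e: "e \<in> mor C" "cod C e = on_obj H (dom C e) \<amalg> T"
    using assms(2) by auto
  have ex1: "\<exists>!g. is_coalgebra_hom C (plus_functor C H Y) X c T t g"
    if "c \<in> mor C" "dom C c = X" "cod C c = on_obj H X \<amalg> Y" for X c
    using final that unfolding is_final_coalgebra_def by (auto simp: coalgebra_iff)
  have g1: "\<exists>!g. ?hom g"
    using e by (intro ex1) simp_all
  then obtain g where hom: "?hom g" by blast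
  then have g: "g \<in> mor C" "dom C g = dom C e \<amalg> T" "cod C g = T"
    and tg: "t \<cdot> g = plus_mor C (on_mor H g) (ident C Y) \<cdot> eq_combine C H Y t e"
    by (auto simp: coalgebra_hom_iff)
  let ?r = "inr C (dom C e) T"
  have "t \<cdot> (g \<cdot> ?r) = (t \<cdot> g) \<cdot> ?r"
    using e g by simp
  also have "\<dots> = plus_mor C (on_mor H g) (ident C Y) \<cdot> (eq_combine C H Y t e \<cdot> ?r)"
    unfolding tg using e g by (simp add: plus_mor_def del: cmp_copair_cmp)
  \<comment> \<open>Here \<open>inr\<close> is a coalgebra homomorphism from \<open>t\<close> to
    \<open>t \<oplus> e\<close>, being a morphism of equations.\<close>
  also have "\<dots> = plus_mor C (on_mor H g) (ident C Y) \<cdot> (plus_mor C (on_mor H ?r) (ident C Y) \<cdot> t)"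
    using e eq_combine_hom_inr [of t Y e] by simp
  also have "\<dots> = plus_mor C (on_mor H (g \<cdot> ?r)) (ident C Y) \<cdot> t"
    using e g by (simp add: plus_mor_def H_cmp)
  finally have "is_coalgebra_hom C (plus_functor C H Y) T t T t (g \<cdot> ?r)"
    using e g by (simp add: coalgebra_hom_iff)
  moreover have "is_coalgebra_hom C (plus_functor C H Y) T t T t (ident C T)"
    by (simp add: coalgebra_hom_iff plus_mor_def)
  ultimately have gr: "g \<cdot> ?r = ident C T"
    using ex1 [of t T] by auto
  have g_eq: "copair C (g \<cdot> inl C (dom C e) T) (ident C T) = g"
    by (rule coproduct_ext [of _ _ "dom C e" T]) (use e g gr in simp_all)
  show ?thesis
  proof
    show "is_solution C H T \<tau> e (g \<cdot> inl C (dom C e) T)"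
      by (subst solution_iff_coalgebra_hom) (use e g hom in \<open>simp_all add: g_eq\<close>)
  next
    fix s assume sol: "is_solution C H T \<tau> e s"
    then have s: "s \<in> mor C" "dom C s = dom C e" "cod C s = T"
      using e by (auto simp: is_solution_def hom_def)
    then have "?hom (copair C s (ident C T))"
      using solution_iff_coalgebra_hom e sol by blast
    then have "copair C s (ident C T) = g"
      using g1 hom by blast
    then have "copair C s (ident C T) \<cdot> inl C (dom C e) T = g \<cdot> inl C (dom C e) T"
      by simp
    then show "s = g \<cdot> inl C (dom C e) T"
      using e s by simp
  qed
qed

end

locale iso_coalgebra_elgot =
  iso_coalgebra C H Y T t \<tau> \<eta> + elgot_algebra C H A \<alpha> sol
  for C :: "('o, 'm, 'z) cop_cat_scheme" (structure) and H Y T t \<tau> \<eta> A \<alpha> sol +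
  fixes m
  assumes m [simp]: "m \<in> mor C" "dom C m = Y" "cod C m = A"
begin

definition "extension = sol (eq_rename C H m t)"

lemma extension_simps [simp]:
  "extension \<in> mor C" "dom C extension = T" "cod C extension = A"
  by (simp_all add: extension_def del: eq_rename_eq)

text \<open>In the unfolded solution equation, \<open>t \<cdot> \<eta> = inr\<close> selects the
  parameter component, which is \<open>m\<close>.\<close>

lemma extension_eta: "extension \<cdot> \<eta> = m"
proof -
  have "copair C (\<alpha> \<cdot> on_mor H extension) (ident C A) \<cdot> eq_rename C H m t = extension"
    unfolding extension_def by (rule sol_eq) simp_all
  then have "copair C (\<alpha> \<cdot> on_mor H extension) m \<cdot> t = extension"
    by simp
  then have "extension \<cdot> \<eta> = (copair C (\<alpha> \<cdot> on_mor H extension) m \<cdot> t) \<cdot> \<eta>"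
    by simp
  also have "\<dots> = m"
    by (simp add: t_eta)
  finally show ?thesis .
qed

text \<open>This is \<open>sol_combine_preserving\<close> for \<open>f = m \<bullet> t\<close>:
  renaming fixes the left summand, so \<open>f \<cdot> \<tau> = inl\<close> follows from
  \<open>t \<cdot> \<tau> = inl\<close>.\<close>

lemma extension_preserving:
  assumes "\<And>e. e \<in> flat_eqs C H T \<Longrightarrow> is_solution C H T \<tau> e (solT e)"
  shows "is_solution_preserving C H T solT A sol extension"
proof -
  have "extension \<cdot> solT e = sol (eq_rename C H extension e)" if "e \<in> flat_eqs C H T" for e
    unfolding extension_def
    by (rule sol_combine_preserving [where \<tau> = \<tau>])
      (use that assms in \<open>simp_all add: t_tau\<close>)
  then show ?thesis
    unfolding is_solution_preserving_def by (simp add: hom_def)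
qed

end

section \<open>The complete Elgot algebra on \<open>HA + Y\<close>\<close>

context elgot_algebra
begin

text \<open>
  Solve \<open>e : X \<rightarrow> HX + (HA + Y)\<close> in \<open>A\<close> after renaming along \<open>[\<alpha>, \<eta>]\<close>, and unfold once so as
  to land in \<open>HA + Y\<close>.
\<close>

definition lift_sol where
  "lift_sol Y \<eta> e = copair C
    (inl C (on_obj H A) Y \<cdot> on_mor H (sol (eq_rename C H (copair C \<alpha> \<eta>) e)))
    (ident C (on_obj H A \<amalg> Y)) \<cdot> e"

context
  fixes Y \<eta> p B
  assumes eta [simp]: "Y \<in> obj C" "\<eta> \<in> mor C" "dom C \<eta> = Y" "cod C \<eta> = A"
  defines p: "p \<equiv> copair C \<alpha> \<eta>"
    and B: "B \<equiv> on_obj H A \<amalg> Y"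
begin

lemma p_simps [simp]: "B \<in> obj C" "p \<in> mor C" "dom C p = B" "cod C p = A"
  by (simp_all add: p B)

lemma lift_sol_eq:
  "lift_sol Y \<eta> e = copair C (inl C (on_obj H A) Y \<cdot> on_mor H (sol (eq_rename C H p e))) (ident C B) \<cdot> e"
  by (simp add: lift_sol_def p B)

lemma lift_sol_simps [simp]:
  assumes "e \<in> mor C" "cod C e = on_obj H (dom C e) \<amalg> B"
  shows "lift_sol Y \<eta> e \<in> mor C" "dom C (lift_sol Y \<eta> e) = dom C e" "cod C (lift_sol Y \<eta> e) = B"
  using assms by (simp_all add: lift_sol_eq B [symmetric] del: eq_rename_eq)

lemma p_inl: "p \<cdot> inl C (on_obj H A) Y = \<alpha>"
  by (simp add: p)

text \<open>With \<open>s\<close> the solution of \<open>p \<bullet> e\<close>, composing with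
  \<open>p\<close> turns \<open>[inl \<cdot> Hs, id] \<cdot> e\<close> into
  \<open>[\<alpha> \<cdot> Hs, p] \<cdot> e\<close>, which is the unfolding of
  \<open>s\<close>.\<close>

lemma p_lift_sol:
  assumes "e \<in> mor C" "cod C e = on_obj H (dom C e) \<amalg> B"
  shows "p \<cdot> lift_sol Y \<eta> e = sol (eq_rename C H p e)"
proof -
  define s where "s = sol (eq_rename C H p e)"
  have s: "s \<in> mor C" "dom C s = dom C e" "cod C s = A"
    using assms by (simp_all add: s_def del: eq_rename_eq)
  have "p \<cdot> lift_sol Y \<eta> e = copair C ((p \<cdot> inl C (on_obj H A) Y) \<cdot> on_mor H s) p \<cdot> e"
    using assms s by (simp add: lift_sol_eq s_def [symmetric] B [symmetric] del: eq_rename_eq)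
  also have "\<dots> = copair C (\<alpha> \<cdot> on_mor H s) (ident C A) \<cdot> eq_rename C H p e"
    using assms s by (simp add: p_inl)
  also have "\<dots> = s"
    unfolding s_def by (rule sol_eq) (use assms in simp_all)
  finally show ?thesis
    by (simp add: s_def)
qed

text \<open>A lifted solution depends on \<open>e\<close> and on the solution of
  \<open>p \<bullet> e\<close> in \<open>A\<close>, so each axiom follows from the same axiom in
  \<open>A\<close> for equations renamed along \<open>p\<close>.\<close>

lemma lift_elgot: "is_complete_elgot C H B (inl C (on_obj H A) Y \<cdot> on_mor H p) (lift_sol Y \<eta>)"
proof -
  let ?i = "inl C (on_obj H A) Y"
  have i [simp]: "?i \<in> mor C" "dom C ?i = on_obj H A" "cod C ?i = B"
    by (simp_all add: B)
  have solution: "is_solution C H B (?i \<cdot> on_mor H p) e (lift_sol Y \<eta> e)"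
    if e: "e \<in> mor C" "cod C e = on_obj H (dom C e) \<amalg> B" for e
  proof -
    have "on_mor H p \<cdot> on_mor H (lift_sol Y \<eta> e) = on_mor H (sol (eq_rename C H p e))"
      using e by (simp add: H_cmp [symmetric] p_lift_sol del: eq_rename_eq)
    then show ?thesis
      by (subst is_solution_iff) (use e in \<open>simp_all add: lift_sol_eq del: eq_rename_eq\<close>)
  qed
  have functorial: "lift_sol Y \<eta> e = lift_sol Y \<eta> f \<cdot> h"
    if e: "e \<in> mor C" "cod C e = on_obj H (dom C e) \<amalg> B"
      and f: "f \<in> mor C" "cod C f = on_obj H (dom C f) \<amalg> B"
      and h: "h \<in> mor C" "dom C h = dom C e" "cod C h = dom C f"
      and eq: "plus_mor C (on_mor H h) (ident C B) \<cdot> e = f \<cdot> h" for e f h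
  proof -
    define s where "s = sol (eq_rename C H p f)"
    have s: "s \<in> mor C" "dom C s = dom C f" "cod C s = A"
      using f by (simp_all add: s_def del: eq_rename_eq)
    have "plus_mor C (on_mor H h) (ident C A) \<cdot> eq_rename C H p e =
        plus_mor C (ident C (on_obj H (dom C f))) p \<cdot> (plus_mor C (on_mor H h) (ident C B) \<cdot> e)"
      using e f h by (simp add: plus_mor_def)
    also have "\<dots> = eq_rename C H p f \<cdot> h"
      unfolding eq using f h by (simp add: plus_mor_def)
    finally have "sol (eq_rename C H p e) = s \<cdot> h"
      unfolding s_def by (intro sol_functorial) (use e f h in simp_all)
    then have "lift_sol Y \<eta> e = copair C (?i \<cdot> on_mor H s) (ident C B) \<cdot>
        (plus_mor C (on_mor H h) (ident C B) \<cdot> e)"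
      using e f h s by (simp add: lift_sol_eq H_cmp plus_mor_def del: eq_rename_eq)
    also have "\<dots> = lift_sol Y \<eta> f \<cdot> h"
      unfolding eq using f h s by (simp add: lift_sol_eq s_def [symmetric] del: eq_rename_eq)
    finally show ?thesis .
  qed
  have compositional: "lift_sol Y \<eta> (eq_rename C H (lift_sol Y \<eta> f) e) =
      lift_sol Y \<eta> (eq_combine C H B f e) \<cdot> inl C (dom C e) (dom C f)"
    if f: "f \<in> mor C" "cod C f = on_obj H (dom C f) \<amalg> B"
      and e: "e \<in> mor C" "cod C e = on_obj H (dom C e) \<amalg> dom C f" for e f
  proof -
    define r where "r = eq_rename C H p f"
    have r: "r \<in> mor C" "dom C r = dom C f" "cod C r = on_obj H (dom C r) \<amalg> A"
      using f by (simp_all add: r_def)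
    define c where "c = eq_combine C H B f e"
    have c: "c \<in> mor C" "dom C c = dom C e \<amalg> dom C f" "cod C c = on_obj H (dom C e \<amalg> dom C f) \<amalg> B"
      using f e by (simp_all add: c_def)
    \<comment> \<open>Combining commutes with renaming, so compositionality in \<open>A\<close>
      applies to \<open>r = p \<bullet> f\<close> and \<open>e\<close>.\<close>
    have pc: "eq_rename C H p c = eq_combine C H A r e"
      using eq_combine_rename [of p f e] f e by (simp add: c_def r_def)
    define u where "u = sol (eq_rename C H p c)"
    have u: "u \<in> mor C" "dom C u = dom C e \<amalg> dom C f" "cod C u = A"
      using c by (simp_all add: u_def del: eq_rename_eq)
    define s where "s = sol (eq_rename C H (sol r) e)"
    have s: "s \<in> mor C" "dom C s = dom C e" "cod C s = A"
      using r e by (simp_all add: s_def del: eq_rename_eq)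
    have ul: "u \<cdot> inl C (dom C e) (dom C f) = s"
      using sol_compositional [of r e] r e by (simp add: u_def pc s_def del: eq_rename_eq)
    have ur: "u \<cdot> inr C (dom C e) (dom C f) = sol r"
      using sol_eq_combine_inr [of r e] r e by (simp add: u_def pc)
    have Hul: "on_mor H u \<cdot> on_mor H (inl C (dom C e) (dom C f)) = on_mor H s"
      and Hur: "on_mor H u \<cdot> on_mor H (inr C (dom C e) (dom C f)) = on_mor H (sol r)"
      using u e f by (simp_all add: H_cmp [symmetric] ul ur)
    \<comment> \<open>The two renamings compose to one along
      \<open>p \<cdot> lift_sol Y \<eta> f\<close>, which equals \<open>sol r\<close>.\<close>
    have "eq_rename C H p (eq_rename C H (lift_sol Y \<eta> f) e) = eq_rename C H (sol r) e"
      using e f by (subst eq_rename_cmp [symmetric]) (simp_all add: p_lift_sol r_def del: eq_rename_eq)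
    then have "lift_sol Y \<eta> (eq_rename C H (lift_sol Y \<eta> f) e) =
        copair C (?i \<cdot> on_mor H s) (ident C B) \<cdot> eq_rename C H (lift_sol Y \<eta> f) e"
      by (simp add: lift_sol_eq s_def del: eq_rename_eq)
    also have "\<dots> = copair C (?i \<cdot> on_mor H s) (lift_sol Y \<eta> f) \<cdot> e"
      using e f s by simp
    also have "\<dots> = (copair C (?i \<cdot> on_mor H u) (ident C B) \<cdot> c) \<cdot> inl C (dom C e) (dom C f)"
      using e f s u r by (simp add: c_def copair_cmp_eq_combine Hul Hur lift_sol_eq [of f]
          r_def [symmetric] del: eq_rename_eq cmp_copair_cmp)
    also have "copair C (?i \<cdot> on_mor H u) (ident C B) \<cdot> c = lift_sol Y \<eta> c"
      by (simp add: lift_sol_eq u_def)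
    finally show ?thesis
      by (simp add: c_def)
  qed
  show ?thesis
    unfolding is_complete_elgot_def
    using solution functorial compositional by (auto simp: hom_def simp del: eq_rename_eq)
qed

lemma p_preserving: "is_solution_preserving C H B (lift_sol Y \<eta>) A sol p"
  unfolding is_solution_preserving_def by (auto simp: hom_def p_lift_sol simp del: eq_rename_eq)

end

end


section \<open>The two implications\<close>

context cat_with_endo
begin

lemma final_imp_free:
  assumes Y: "Y \<in> obj C" and final: "is_final_coalgebra C (plus_functor C H Y) T t"
  shows "\<exists>\<tau> sol \<eta>. is_free_complete_elgot C H Y T \<tau> sol \<eta>"
proof -
  have T: "T \<in> obj C"
    and t: "t \<in> mor C" "dom C t = T" "cod C t = on_obj H T \<amalg> Y"
    using final Y by (auto simp: is_final_coalgebra_def is_coalgebra_def plus_functor_def hom_def)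
  obtain u where u: "u \<in> mor C" "dom C u = on_obj H T \<amalg> Y" "cod C u = T"
    and tu: "t \<cdot> u = ident C (on_obj H T \<amalg> Y)" and ut: "u \<cdot> t = ident C T"
    using final_coalgebra_inverse [OF Y final] .
  define \<tau> where "\<tau> = u \<cdot> inl C (on_obj H T) Y"
  define \<eta> where "\<eta> = u \<cdot> inr C (on_obj H T) Y"
  have u_eq: "copair C \<tau> \<eta> = u"
    by (rule coproduct_ext [of _ _ "on_obj H T" Y]) (use Y T u in \<open>simp_all add: \<tau>_def \<eta>_def\<close>)
  interpret iso_coalgebra C H Y T t \<tau> \<eta>
  proof
    have "t \<cdot> \<tau> = (t \<cdot> u) \<cdot> inl C (on_obj H T) Y" "t \<cdot> \<eta> = (t \<cdot> u) \<cdot> inr C (on_obj H T) Y"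
      using Y T t u by (simp_all add: \<tau>_def \<eta>_def)
    then show "t \<cdot> \<tau> = inl C (on_obj H T) Y" "t \<cdot> \<eta> = inr C (on_obj H T) Y"
      using Y T by (simp_all add: tu)
  qed (use Y T t u ut u_eq in \<open>simp_all add: \<tau>_def \<eta>_def\<close>)
  define sol where "sol e = (THE s. is_solution C H T \<tau> e s)" for e
  note ex1 = final_unique_solution [OF final]
  have elgot: "is_complete_elgot C H T \<tau> sol"
    unfolding sol_def by (rule unique_solutions_elgot) (use ex1 in simp_all)
  have solution: "is_solution C H T \<tau> e (sol e)" if "e \<in> flat_eqs C H T" for e
    unfolding sol_def by (rule theI') (rule ex1 [OF that])
  let ?et = "eq_rename C H \<eta> t"
  \<comment> \<open>For the identity the right-hand side of the solution equation collapses to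
    \<open>[\<tau>, \<eta>] \<cdot> t\<close>.\<close>
  have "is_solution C H T \<tau> ?et (ident C T)"
    by (subst is_solution_iff) (simp_all add: copair_t)
  moreover have et: "?et \<in> flat_eqs C H T"
    by simp
  ultimately have sol_et: "sol ?et = ident C T"
    using ex1 solution by blast
  have universal: "\<exists>!h. is_solution_preserving C H T sol A sol' h \<and> h \<cdot> \<eta> = m"
    if A: "is_complete_elgot C H A \<alpha> sol'" and m: "m \<in> hom C Y A" for A \<alpha> sol' m
  proof -
    interpret A: iso_coalgebra_elgot C H Y T t \<tau> \<eta> A \<alpha> sol' m
      by unfold_locales (use A m in \<open>auto simp: hom_def\<close>)
    show ?thesis
    proof
      show "is_solution_preserving C H T sol A sol' A.extension \<and> A.extension \<cdot> \<eta> = m"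
        using A.extension_preserving solution A.extension_eta by blast
    next
      fix h assume h: "is_solution_preserving C H T sol A sol' h \<and> h \<cdot> \<eta> = m"
      then have h': "h \<in> mor C" "dom C h = T" "cod C h = A"
        by (auto simp: is_solution_preserving_def hom_def)
      have "h = h \<cdot> sol ?et"
        using h' by (simp add: sol_et del: eq_rename_eq)
      also have "\<dots> = sol' (eq_rename C H h ?et)"
        using h et unfolding is_solution_preserving_def by blast
      also have "eq_rename C H h ?et = eq_rename C H m t"
        using h h' eq_rename_cmp [of t Y \<eta> h] by simp
      finally show "h = A.extension"
        by (simp add: A.extension_def)
    qed
  qed
  have "is_free_complete_elgot C H Y T \<tau> sol \<eta>"
    unfolding is_free_complete_elgot_def
    by (intro conjI allI impI elgot, simp add: hom_def, elim conjE, rule universal)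
  then show ?thesis by blast
qed

text \<open>Freeness yields a solution-preserving \<open>q : T \<rightarrow> HT + Y\<close> with
  \<open>q \<cdot> \<eta> = inr\<close>. For \<open>p = [\<tau>, \<eta>]\<close>, the composite
  \<open>p \<cdot> q\<close> preserves solutions and fixes \<open>\<eta>\<close>, so it is the
  identity. As \<open>q\<close> is an algebra morphism,
  \<open>q \<cdot> \<tau> = inl \<cdot> H(p \<cdot> q) = inl\<close>.\<close>

lemma free_imp_iso_coalgebra:
  assumes Y: "Y \<in> obj C" and free: "is_free_complete_elgot C H Y T \<tau> sol \<eta>"
  shows "\<exists>t. iso_coalgebra C H Y T t \<tau> \<eta>"
proof -
  interpret T: elgot_algebra C H T \<tau> sol
    by unfold_locales (rule is_free_complete_elgotD(1) [OF free])
  have eta: "\<eta> \<in> mor C" "dom C \<eta> = Y" "cod C \<eta> = T"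
    using is_free_complete_elgotD(2) [OF free] by (auto simp: hom_def)
  define B where "B = on_obj H T \<amalg> Y"
  define p where "p = copair C \<tau> \<eta>"
  let ?i = "inl C (on_obj H T) Y" and ?j = "inr C (on_obj H T) Y"
  have p: "p \<in> mor C" "dom C p = B" "cod C p = T"
    using eta by (simp_all add: p_def B_def)
  have elgot: "is_complete_elgot C H B (?i \<cdot> on_mor H p) (T.lift_sol Y \<eta>)"
    unfolding p_def B_def by (rule T.lift_elgot) (use Y eta in auto)
  have p_preserving: "is_solution_preserving C H B (T.lift_sol Y \<eta>) T sol p"
    unfolding p_def B_def by (rule T.p_preserving) (use Y eta in auto)
  have "?j \<in> hom C Y B"
    using Y by (simp add: hom_def B_def)
  then obtain q where q_preserving: "is_solution_preserving C H T sol B (T.lift_sol Y \<eta>) q"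
    and q_eta: "q \<cdot> \<eta> = ?j"
    using is_free_complete_elgotD(3) [OF free elgot] by blast
  have q: "q \<in> mor C" "dom C q = T" "cod C q = B"
    using q_preserving by (auto simp: is_solution_preserving_def hom_def)
  have pq_preserving: "is_solution_preserving C H T sol T sol (p \<cdot> q)"
    by (rule solution_preserving_cmp [OF q_preserving p_preserving]) (simp add: hom_def)
  have pq_eta: "(p \<cdot> q) \<cdot> \<eta> = \<eta>"
    using Y p q eta by (simp add: q_eta) (simp add: p_def)
  have ex1: "\<exists>!h. is_solution_preserving C H T sol T sol h \<and> h \<cdot> \<eta> = \<eta>"
    by (rule is_free_complete_elgotD(3) [OF free T.elgot is_free_complete_elgotD(2) [OF free]])
  have pq: "p \<cdot> q = ident C T"
    by (rule ex1E [OF ex1]) (metis pq_preserving pq_eta T.solution_preserving_ident ident_cmp eta(1,3))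
  interpret TB: two_elgot_algebras C H T \<tau> sol B "?i \<cdot> on_mor H p" "T.lift_sol Y \<eta>"
    by unfold_locales (rule elgot)
  have "q \<cdot> \<tau> = (?i \<cdot> on_mor H p) \<cdot> on_mor H q"
    by (rule TB.solution_preserving_hom [OF q_preserving])
  also have "\<dots> = ?i \<cdot> on_mor H (p \<cdot> q)"
    using Y p q by (simp add: H_cmp)
  also have "\<dots> = ?i"
    using Y by (simp add: pq)
  finally have "q \<cdot> \<tau> = ?i" .
  then have "iso_coalgebra C H Y T q \<tau> \<eta>"
    by unfold_locales (use Y q eta q_eta pq in \<open>simp_all add: p_def B_def\<close>)
  then show ?thesis by blast
qed

lemma free_imp_final:
  assumes Y: "Y \<in> obj C" and free: "is_free_complete_elgot C H Y T \<tau> sol \<eta>"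
  shows "\<exists>t. is_final_coalgebra C (plus_functor C H Y) T t"
proof -
  obtain t where "iso_coalgebra C H Y T t \<tau> \<eta>"
    using free_imp_iso_coalgebra [OF assms] by blast
  then interpret iso_coalgebra C H Y T t \<tau> \<eta> .
  interpret iso_coalgebra_elgot C H Y T t \<tau> \<eta> T \<tau> sol \<eta>
    by unfold_locales (simp_all add: is_free_complete_elgotD(1) [OF free])
  have ex1: "\<exists>!h. is_solution_preserving C H T sol T sol h \<and> h \<cdot> \<eta> = \<eta>"
    by (rule is_free_complete_elgotD(3) [OF free elgot is_free_complete_elgotD(2) [OF free]])
  have "is_solution_preserving C H T sol T sol extension"
    by (rule extension_preserving) (rule is_complete_elgotD(5) [OF elgot])
  then have ext: "extension = ident C T"
    by - (rule ex1E [OF ex1], metis extension_eta solution_preserving_ident ident_cmp eta(1,3))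
  have "\<exists>!h. is_coalgebra_hom C (plus_functor C H Y) X c T t h"
    if "is_coalgebra C (plus_functor C H Y) X c" for X c
  proof
    have c: "c \<in> mor C" "dom C c = X" "cod C c = on_obj H X \<amalg> Y" and X: "X \<in> obj C"
      using that Y by (auto simp: coalgebra_iff)
    let ?e = "eq_rename C H \<eta> c"
    have s: "sol ?e \<in> mor C" "dom C (sol ?e) = X" "cod C (sol ?e) = T"
      using c by (simp_all del: eq_rename_eq)
    have "copair C (\<tau> \<cdot> on_mor H (sol ?e)) (ident C T) \<cdot> ?e = sol ?e"
      by (rule sol_eq) (use c X in simp_all)
    then have "t \<cdot> sol ?e = t \<cdot> (copair C (\<tau> \<cdot> on_mor H (sol ?e)) (ident C T) \<cdot> ?e)"
      by (simp del: eq_rename_eq)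
    \<comment> \<open>Bracketed so that \<open>t \<cdot> \<tau> = inl\<close> and
      \<open>t \<cdot> \<eta> = inr\<close> turn the solution equation into the homomorphism
      equation.\<close>
    also have "\<dots> = copair C ((t \<cdot> \<tau>) \<cdot> on_mor H (sol ?e)) (t \<cdot> \<eta>) \<cdot> c"
      using c s X by (simp del: eq_rename_eq add: eq_rename_eq [of c Y])
    also have "\<dots> = plus_mor C (on_mor H (sol ?e)) (ident C Y) \<cdot> c"
      using c s X by (simp add: t_tau t_eta plus_mor_def del: eq_rename_eq)
    finally show "is_coalgebra_hom C (plus_functor C H Y) X c T t (sol ?e)"
      using s by (simp add: coalgebra_hom_iff del: eq_rename_eq)
  next
    fix h assume "is_coalgebra_hom C (plus_functor C H Y) X c T t h"
    then have h: "h \<in> mor C" "dom C h = X" "cod C h = T"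
      and th: "t \<cdot> h = plus_mor C (on_mor H h) (ident C Y) \<cdot> c"
      by (auto simp: coalgebra_hom_iff)
    have c: "c \<in> mor C" "dom C c = X" "cod C c = on_obj H X \<amalg> Y" and X: "X \<in> obj C"
      using that Y by (auto simp: coalgebra_iff)
    \<comment> \<open>Renaming the homomorphism equation of \<open>h\<close> along
      \<open>\<eta>\<close> makes \<open>h\<close> a morphism of equations from
      \<open>\<eta> \<bullet> c\<close> to \<open>\<eta> \<bullet> t\<close>.\<close>
    have "sol (eq_rename C H \<eta> c) = extension \<cdot> h"
      unfolding extension_def
      by (rule sol_functorial) (use c h X th in \<open>simp_all add: plus_mor_def\<close>)
    then show "h = sol (eq_rename C H \<eta> c)"
      using h by (simp add: ext)
  qed
  then have "is_final_coalgebra C (plus_functor C H Y) T t"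
    unfolding is_final_coalgebra_def by (intro conjI allI impI) (simp_all add: coalgebra_iff)
  then show ?thesis by blast
qed

end

theorem theorem5p4:
  fixes C :: "('o, 'm) cop_cat" and H :: "('o, 'm) endo" and Y TY :: 'o
  assumes "category_with_finite_coproducts C"
    and "is_endofunctor C H"
    and "Y \<in> obj C"
    and "TY \<in> obj C"
  shows "(\<exists>t. is_final_coalgebra C (plus_functor C H Y) TY t) \<longleftrightarrow>
    (\<exists>\<tau> sol \<eta>. is_free_complete_elgot C H Y TY \<tau> sol \<eta>)"
proof -
  interpret cat_with_endo C H
    using assms by (simp add: cat_with_endo_def cat_with_endo_axioms_def)
  show ?thesis
    using final_imp_free free_imp_final assms(3) by blast
qed

end
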